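(* Let $d,m\ge1$ be integers, let $A$ be a $(d+1)\times m$ real matrix with diophantine exponent $\omega(A)=\omega$, let $\tau_0:=\frac{1}{\max\{m,\omega\}}$, and let $\varepsilon$ be a positive number less than $\tau_0$. Then for any ball $\mathcal{B}\subseteq\mathcal{U}=[0,1]^d$ there exists $\kappa\in(0,1)$ depending on $\mathcal{B}$, and a constant $Q_0(A,\varepsilon,\mathcal{B})$, such that for every positive integer $Q\ge Q_0(A,\varepsilon,\mathcal{B})$ and every $\delta$ satisfying $1\ge\delta\ge Q^{-\tau_0+\varepsilon}$ we have $$\mu_d\left(\mathcal{B}\cap\bigcup_{(q,\bm{a})\in\mathcal{R}_A^\kappa(Q,\delta)}B\left(\frac{\bm{a}}{q},\frac{\kappa^{-1}}{Q^{\frac{d+1}{d}}\delta^{\frac{m}{d}}}\right)\right)\ge\frac12\mu_d(\mathcal{B}).$$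
   Context: Vectors are row vectors; $|\cdot|$ is the supremum norm; $\|\bm{y}\|$ is the sup-norm distance of $\bm{y}$ to the nearest integer vector (also for column vectors). $\mu_d$ is Lebesgue measure on $\mathbb{R}^d$, and $B(\bm{x},r)=\{\bm{y}\in\mathbb{R}^d:|\bm{y}-\bm{x}|<r\}$ (balls are with respect to the supremum norm). The diophantine exponent $\omega(A)$ of a real matrix $A$ with $m$ columns is the supremum of all $\omega\in\mathbb{R}$ such that $\|A\bm{q}^{\mathrm T}\|<|\bm{q}|^{-\omega}$ holds for infinitely many $\bm{q}\in\mathbb{Z}^m$. For $0\le\kappa<1$, $$\mathcal{R}_A^\kappa(Q,\delta)=\{(q,\bm{a})\in\mathbb{N}\times\mathbb{Z}^d:\ \bm{a}/q\in\mathcal{U},\ \kappa Q<q\le Q,\ \|(q,\bm{a})A\|<\delta\}.$$ *)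

theory Defs
  imports "HOL-Analysis.Analysis"
begin

text \<open>
  Dimensions are types: \<open>d = CARD('d)\<close> and \<open>m = CARD('m)\<close>, both at least 1.  A \<open>(d + 1) \<times> m\<close> matrix
  has type \<open>real ^ 'm ^ ('d option)\<close>; its row \<open>None\<close> is multiplied by \<open>q\<close> and its row \<open>Some i\<close> by
  \<open>a $ i\<close> in the row vector product \<open>(q, a) A\<close>.  The supremum norm is \<^const>\<open>infnorm\<close>.
\<close>

definition ivec :: "int ^ 'n \<Rightarrow> real ^ 'n" where
  "ivec p = (\<chi> i. of_int (p $ i))"

definition int_dist :: "real ^ 'n \<Rightarrow> real" where
  "int_dist y = (INF p. infnorm (y - ivec p))"

definition sup_ball :: "real ^ 'd \<Rightarrow> real \<Rightarrow> (real ^ 'd) set" where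
  "sup_ball x r = {y. infnorm (y - x) < r}"

definition unit_cube :: "(real ^ 'd) set" where
  "unit_cube = {x. \<forall>i. 0 \<le> x $ i \<and> x $ i \<le> 1}"

text \<open>The exponent may be \<open>\<infinity>\<close>, hence the extended reals.\<close>

definition dioph_exponent :: "real ^ 'm ^ 'k \<Rightarrow> ereal" where
  "dioph_exponent A =
     Sup {ereal w | w. infinite {q :: int ^ 'm. int_dist (A *v ivec q) < infnorm (ivec q) powr (- w)}}"

text \<open>
  The quotient is formed in the extended reals and lies in \<open>[0, 1]\<close>; it is \<open>0\<close> when the exponent
  is \<open>\<infinity>\<close>.
\<close>

definition tau0 :: "real ^ 'm ^ 'k \<Rightarrow> real" where
  "tau0 A = real_of_ereal (1 / max (ereal (real CARD('m))) (dioph_exponent A))"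

definition qa_vec :: "nat \<Rightarrow> int ^ 'd \<Rightarrow> real ^ ('d option)" where
  "qa_vec q a = (\<chi> j. case j of None \<Rightarrow> real q | Some i \<Rightarrow> of_int (a $ i))"

definition rat_point :: "nat \<Rightarrow> int ^ 'd \<Rightarrow> real ^ 'd" where
  "rat_point q a = (1 / real q) *\<^sub>R ivec a"

definition approx_set ::
    "real ^ 'm ^ ('d option) \<Rightarrow> real \<Rightarrow> nat \<Rightarrow> real \<Rightarrow> (nat \<times> (int ^ 'd)) set" where
  "approx_set A \<kappa> Q \<delta> =
     {(q, a). 0 < q \<and> rat_point q a \<in> unit_cube \<and> \<kappa> * real Q < real q \<and> q \<le> Q \<and>
        int_dist (qa_vec q a v* A) < \<delta>}"

end

theory Submission
  imports Defs "HOL-Library.Real_Mod"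
begin

text \<open>
  Let \<open>\<rho>\<close> be \<open>Q \<delta>\<^sup>m\<close> to the power \<open>-1/d\<close>.  For large \<open>Q\<close> the pigeonhole principle gives, for every point \<open>y\<close>, a pair
  \<open>(q, a)\<close> with \<open>1 \<le> q \<le> Q\<close>, \<open>|q y - a| < \<eta> = 2\<^sup>m\<^sup>+\<^sup>1 \<rho>\<close> and \<open>(q, a) A\<close> within \<open>\<delta>\<close> of an integer
  vector (\<open>exists_rational_approximation\<close>).  If \<open>q > \<beta> Q\<close>, then \<open>a / q\<close> is the centre of one of the balls,
  at distance less than \<open>\<eta> / (\<beta> Q)\<close> from \<open>y\<close>, and this is the radius in the theorem when
  \<open>\<kappa> = \<beta> / 2\<^sup>m\<^sup>+\<^sup>1\<close>.  For \<open>y\<close> in a slightly smaller concentric ball, \<open>a / q\<close> lies in the unit cube, as it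
  must.  It remains to bound the measure of the points \<open>y\<close> for which \<open>q \<le> \<beta> Q\<close>.

  These lie in the union of the balls of radius \<open>\<eta> / q\<close> about the \<open>a / q\<close> with \<open>q \<le> \<beta> Q\<close> and \<open>(q, a) A\<close>
  nearly integral, so the task is to count integer vectors \<open>v\<close> of size at most \<open>T\<close> with \<open>v A\<close> nearly
  integral.  The expected number is \<open>\<delta>\<^sup>m T\<^sup>d\<^sup>+\<^sup>1\<close>, and a bound of this order holds for
  the following dual reason (\<open>card_near_integral_le\<close>).  Suppose that no nonzero integer vector \<open>k\<close> with
  entries at most \<open>K\<close>, where \<open>K\<close> is of order \<open>1/\<delta>\<close>, has \<open>A k\<close> within \<open>1/P\<close> of an integer vector, where
  \<open>P\<close> is of order \<open>T\<close>.  Then the points \<open>A k\<close> with entries of \<open>k\<close> in \<open>{0..K}\<close> fall into distinct cells of the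
  torus grid of mesh \<open>1/P\<close>, while every \<open>v\<close> that is counted has inner products with the corresponding grid points
  close to integers: the exponential sum over these grid points is at least half of its trivial bound at
  each such \<open>v\<close>.  Parseval's identity on \<open>(\<int>/P\<int>)\<^sup>d\<^sup>+\<^sup>1\<close> admits only few such \<open>v\<close>.

  The hypothesis on \<open>A k\<close> comes from the diophantine exponent: for \<open>0 < s < \<tau>\<^sub>0\<close> the distance of \<open>A k\<close> to the
  integer vectors is at least a constant times \<open>|k|\<close> to the power \<open>-1/s\<close>
  (\<open>dioph_exponent_lower_bound\<close>).  Taking \<open>K\<close> as large as
  both restrictions permit gives the count \<open>T\<^sup>d\<^sup>+\<^sup>1 (\<delta>\<^sup>m + T\<^sup>-\<^sup>s\<^sup>m)\<close> up to constants, the first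
  of which depends on \<open>d\<close> and \<open>m\<close> alone (\<open>card_near_integral_diophantine\<close>).  Summing over dyadic
  blocks of denominators, the bad set has measure at most a constant times \<open>\<beta>\<close>, plus an
  \<open>A\<close>-dependent constant times \<open>Q\<^sup>-\<^sup>s\<^sup>m \<delta>\<^sup>-\<^sup>m\<close>.
  The choice of \<open>\<beta>\<close> makes the first term small compared with the ball, uniformly in \<open>A\<close>; with
  \<open>s = \<tau>\<^sub>0 - \<epsilon>/2\<close> the second tends to \<open>0\<close>, because \<open>\<delta>\<close> is at least \<open>Q\<close> to the power \<open>\<epsilon> - \<tau>\<^sub>0\<close>.
\<close>

section \<open>Distance to the integer vectors\<close>

lemma infnorm_less_iff_cart:
  fixes y :: "real ^ 'n"
  shows "infnorm y < r \<longleftrightarrow> (\<forall>i. \<bar>y $ i\<bar> < r)"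
  unfolding infnorm_Max
  by (subst Max_less_iff) (auto simp: Basis_vec_def inner_axis)

lemma infnorm_le_iff_cart:
  fixes y :: "real ^ 'n"
  shows "infnorm y \<le> r \<longleftrightarrow> (\<forall>i. \<bar>y $ i\<bar> \<le> r)"
  unfolding infnorm_Max
  by (subst Max_le_iff) (auto simp: Basis_vec_def inner_axis)

lemma int_dist_bdd_below: "bdd_below (range (\<lambda>p. infnorm (y - ivec p)))"
  by (rule bdd_belowI[of _ 0]) (auto simp: infnorm_pos_le)

lemma int_dist_less_iff: "int_dist y < e \<longleftrightarrow> (\<exists>p. infnorm (y - ivec p) < e)"
  unfolding int_dist_def
  by (subst cINF_less_iff) (auto simp: int_dist_bdd_below)

lemma int_dist_nonneg: "0 \<le> int_dist y"
  unfolding int_dist_def by (rule cINF_greatest) (auto simp: infnorm_pos_le)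

section \<open>Exponential sums on a finite torus\<close>

lemma sum_cis_roots:
  fixes h :: int
  assumes P: "0 < P"
  shows "(\<Sum>j<P. cis (2 * pi * (real j * of_int h / real P))) = (if int P dvd h then of_nat P else 0)"
proof -
  define z where "z = cis (2 * pi * (of_int h / real P))"
  have pw: "cis (2 * pi * (real j * of_int h / real P)) = z ^ j" for j
    unfolding z_def by (subst Complex.DeMoivre) (simp add: algebra_simps)
  have zP: "z ^ P = 1"
    unfolding pw[symmetric] using P by simp
  show ?thesis
  proof (cases "int P dvd h")
    case True
    then obtain c where c: "h = int P * c" by blast
    have "z = 1" unfolding z_def c using P by simp
    then show ?thesis using True unfolding pw by simp
  next
    case False
    have "z \<noteq> 1"
    proof
      assume "z = 1"
      then obtain n :: int where "2 * pi * (of_int h / real P) = of_int n * (2 * pi)"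
        unfolding z_def cis_eq_1_iff by blast
      then have "real_of_int h = of_int (n * int P)"
        using P by (simp add: field_simps)
      then have "h = n * int P" by linarith
      then show False using False by simp
    qed
    then show ?thesis using False unfolding pw by (simp add: sum_gp_strict zP)
  qed
qed

lemma sum_characters:
  fixes h :: "'n::finite \<Rightarrow> int"
  assumes P: "0 < P"
  shows "(\<Sum>u\<in>Pi\<^sub>E UNIV (\<lambda>_. {..<P}). cis (2 * pi * ((\<Sum>i\<in>UNIV. real (u i) * of_int (h i)) / real P)))
    = (if \<forall>i. int P dvd h i then of_nat (P ^ CARD('n)) else 0)"
proof -
  have "cis (2 * pi * ((\<Sum>i\<in>UNIV. real (u i) * of_int (h i)) / real P))
      = (\<Prod>i\<in>UNIV. cis (2 * pi * (real (u i) * of_int (h i) / real P)))" for u :: "'n \<Rightarrow> nat"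
  proof -
    have "cis (\<Sum>i\<in>X. f i) = (\<Prod>i\<in>X. cis (f i))" if "finite X" for f :: "'n \<Rightarrow> real" and X
      using that by (induction X) (auto simp flip: cis_mult)
    from this[of UNIV, symmetric] show ?thesis
      by (simp add: sum_distrib_left sum_divide_distrib)
  qed
  then have "(\<Sum>u\<in>Pi\<^sub>E UNIV (\<lambda>_. {..<P}). cis (2 * pi * ((\<Sum>i\<in>UNIV. real (u i) * of_int (h i)) / real P)))
    = (\<Prod>i\<in>UNIV. \<Sum>j<P. cis (2 * pi * (real j * of_int (h i) / real P)))"
    by (simp add: prod_sum_PiE)
  also have "\<dots> = (\<Prod>i\<in>UNIV. if int P dvd h i then of_nat P else 0)"
    unfolding sum_cis_roots[OF P] ..
  also have "\<dots> = (if \<forall>i. int P dvd h i then of_nat (P ^ CARD('n)) else 0)"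
    by (auto intro: prod_zero)
  finally show ?thesis .
qed

text \<open>
  The functions \<open>u \<mapsto> e(u \<cdot> g k / P)\<close> are characters of \<open>(\<int>/P\<int>)\<^sup>n\<close>.  They are pairwise distinct, hence
  orthogonal, as soon as the \<open>g k\<close> are distinct modulo \<open>P\<close>, so expanding the square leaves the diagonal.
\<close>

lemma parseval_residues:
  fixes g :: "'k \<Rightarrow> 'n::finite \<Rightarrow> int"
  assumes P: "0 < P" and S: "finite S"
    and sep: "\<And>k l. k \<in> S \<Longrightarrow> l \<in> S \<Longrightarrow> (\<And>i. int P dvd g k i - g l i) \<Longrightarrow> k = l"
  shows "(\<Sum>u\<in>Pi\<^sub>E UNIV (\<lambda>_. {..<P}).
      (cmod (\<Sum>k\<in>S. cis (2 * pi * ((\<Sum>i\<in>UNIV. real (u i) * of_int (g k i)) / real P))))\<^sup>2)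
    = real (P ^ CARD('n) * card S)"
proof -
  let ?U = "Pi\<^sub>E UNIV (\<lambda>_. {..<P}) :: ('n \<Rightarrow> nat) set"
  define t where "t u k = (\<Sum>i\<in>UNIV. real (u i) * of_int (g k i)) / real P" for u :: "'n \<Rightarrow> nat" and k
  have diff: "cis (2 * pi * t u k) * cnj (cis (2 * pi * t u l))
      = cis (2 * pi * ((\<Sum>i\<in>UNIV. real (u i) * of_int (g k i - g l i)) / real P))" for u k l
    by (simp add: cis_cnj cis_mult t_def sum_subtractf diff_divide_distrib algebra_simps)
  have "complex_of_real (\<Sum>u\<in>?U. (cmod (\<Sum>k\<in>S. cis (2 * pi * t u k)))\<^sup>2)
      = (\<Sum>u\<in>?U. \<Sum>k\<in>S. \<Sum>l\<in>S. cis (2 * pi * t u k) * cnj (cis (2 * pi * t u l)))"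
    unfolding of_real_sum complex_norm_square cnj_sum sum_product ..
  also have "\<dots> = (\<Sum>k\<in>S. \<Sum>l\<in>S. \<Sum>u\<in>?U. cis (2 * pi * t u k) * cnj (cis (2 * pi * t u l)))"
    by (subst sum.swap, rule sum.cong[OF refl], rule sum.swap)
  also have "\<dots> = (\<Sum>k\<in>S. \<Sum>l\<in>S. if k = l then of_nat (P ^ CARD('n)) else 0)"
    unfolding diff sum_characters[OF P] using sep by (intro sum.cong refl) auto
  also have "\<dots> = complex_of_real (real (P ^ CARD('n) * card S))"
    using S by (simp add: mult.commute)
  finally show ?thesis unfolding t_def of_real_eq_iff .
qed

lemma Re_cis_near_integer:
  fixes t :: real and z :: int
  assumes "\<bar>t - of_int z\<bar> \<le> 1 / 6"
  shows "1 / 2 \<le> Re (cis (2 * pi * t))"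
proof -
  define s where "s = \<bar>t - of_int z\<bar>"
  have "cis (2 * pi * t) = cis (2 * pi * of_int z) * cis (2 * pi * (t - of_int z))"
    by (simp add: cis_mult algebra_simps del: cis_multiple_2pi)
  then have "Re (cis (2 * pi * t)) = cos (2 * pi * (t - of_int z))"
    by simp
  also have "\<dots> = cos (2 * pi * s)"
    using cos_abs_real[of "2 * pi * (t - of_int z)"] by (simp add: s_def abs_mult)
  also have "\<dots> \<ge> cos (pi / 3)"
    using assms unfolding s_def[symmetric]
    by (intro cos_monotone_0_pi_le) (auto simp: s_def field_simps)
  finally show ?thesis by (simp add: cos_60)
qed

section \<open>Counting integer vectors with nearly integral image\<close>

text \<open>
  The duality argument.  The hypothesis on \<open>k\<close> separates the points \<open>A k\<close> on the torus, so that rounding them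
  down to the grid of mesh \<open>1/P\<close> keeps them distinct.  For \<open>v\<close> in \<open>V\<close> the phase \<open>v \<cdot> A k = (v A) \<cdot> k\<close> is
  within \<open>1/12\<close> of an integer because \<open>v A\<close> is nearly integral, and rounding costs another \<open>1/12\<close> because
  \<open>P = 12 n T\<close>; so all terms of the exponential sum have real part at least \<open>1/2\<close>, and Parseval's identity
  bounds how often that can happen.
\<close>

lemma card_near_integral_le:
  fixes A :: "real ^ 'm ^ 'n" and T K :: nat and \<delta> :: real
  defines "P \<equiv> 12 * CARD('n) * T"
  assumes T: "1 \<le> T"
    and K: "12 * real CARD('m) * real K * \<delta> \<le> 1"
    and dual: "\<And>k :: int ^ 'm. k \<noteq> 0 \<Longrightarrow> (\<And>j. \<bar>k $ j\<bar> \<le> int K) \<Longrightarrow> 1 / real P \<le> int_dist (A *v ivec k)"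
    and V: "\<And>v. v \<in> V \<Longrightarrow> (\<forall>i. \<bar>v $ i\<bar> \<le> int T) \<and> int_dist (ivec v v* A) < \<delta>"
  shows "card V * (K + 1) ^ CARD('m) \<le> 4 * P ^ CARD('n)"
proof -
  have P: "0 < P" and Pn: "real P = 12 * real CARD('n) * real T"
    using T by (auto simp: P_def)
  define S :: "('m \<Rightarrow> int) set" where "S = Pi\<^sub>E UNIV (\<lambda>_. {0..int K})"
  have S: "finite S" and cardS: "card S = (K + 1) ^ CARD('m)"
    unfolding S_def by (auto intro!: finite_PiE simp: card_PiE nat_add_distrib)
  \<comment> \<open>The points of the torus attached to the \<open>k\<close>, and their rounding to the grid.\<close>
  define \<theta> where "\<theta> k = A *v ivec (\<chi> j. k j)" for k :: "'m \<Rightarrow> int"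
  define g where "g k i = \<lfloor>real P * \<theta> k $ i\<rfloor>" for k i
  have g: "\<bar>\<theta> k $ i - of_int (g k i) / real P\<bar> \<le> 1 / real P"
      "of_int (g k i) \<le> real P * \<theta> k $ i" "real P * \<theta> k $ i < of_int (g k i) + 1" for k i
  proof -
    show *: "of_int (g k i) \<le> real P * \<theta> k $ i" "real P * \<theta> k $ i < of_int (g k i) + 1"
      unfolding g_def by linarith+
    have "\<bar>real P * \<theta> k $ i - of_int (g k i)\<bar> / real P \<le> 1 / real P"
      using * by (intro divide_right_mono) auto
    also have "\<bar>real P * \<theta> k $ i - of_int (g k i)\<bar> / real P = \<bar>\<theta> k $ i - of_int (g k i) / real P\<bar>"
    proof -
      have "\<theta> k $ i - of_int (g k i) / real P = (real P * \<theta> k $ i - of_int (g k i)) / real P"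
        using P by (simp add: field_simps)
      then show ?thesis by simp
    qed
    finally show "\<bar>\<theta> k $ i - of_int (g k i) / real P\<bar> \<le> 1 / real P" .
  qed
  have sep: "k = l" if "k \<in> S" "l \<in> S" and dv: "\<And>i. int P dvd g k i - g l i" for k l
  proof (rule ccontr)
    assume "k \<noteq> l"
    define kl :: "int ^ 'm" where "kl = (\<chi> j. k j - l j)"
    have "kl \<noteq> 0" using \<open>k \<noteq> l\<close> by (auto simp: kl_def vec_eq_iff fun_eq_iff)
    moreover have "\<bar>kl $ j\<bar> \<le> int K" for j
    proof -
      have "k j \<in> {0..int K}" "l j \<in> {0..int K}" using that unfolding S_def by blast+
      then show ?thesis by (auto simp: kl_def)
    qed
    ultimately have far: "1 / real P \<le> int_dist (A *v ivec kl)" by (rule dual)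
    have Akl: "A *v ivec kl = \<theta> k - \<theta> l"
      unfolding \<theta>_def matrix_vector_mult_diff_distrib[symmetric]
      by (rule arg_cong[of _ _ "\<lambda>z. A *v z"]) (simp add: vec_eq_iff ivec_def kl_def)
    define p :: "int ^ 'n" where "p = (\<chi> i. (g k i - g l i) div int P)"
    have "\<bar>(\<theta> k - \<theta> l - ivec p) $ i\<bar> < 1 / real P" for i
    proof -
      have "g k i - g l i = int P * p $ i" using dv[of i] by (simp add: p_def)
      then have "of_int (g k i) - of_int (g l i) = real P * of_int (p $ i)"
        by (metis of_int_diff of_int_mult of_int_of_nat_eq)
      then have "\<bar>real P * ((\<theta> k - \<theta> l - ivec p) $ i)\<bar> < 1"
        using g(2,3)[of k i] g(2,3)[of l i] by (simp add: ivec_def algebra_simps)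
      then show ?thesis using P by (simp add: abs_mult pos_less_divide_eq mult.commute)
    qed
    then have "int_dist (A *v ivec kl) < 1 / real P"
      unfolding Akl int_dist_less_iff infnorm_less_iff_cart by blast
    with far show False by simp
  qed
  define t where "t u k = (\<Sum>i\<in>UNIV. real (u i) * of_int (g k i)) / real P" for u :: "'n \<Rightarrow> nat" and k
  let ?U = "Pi\<^sub>E UNIV (\<lambda>_. {..<P}) :: ('n \<Rightarrow> nat) set"
  \<comment> \<open>The entries of \<open>v\<close> are smaller than \<open>P/2\<close>, so reduction modulo \<open>P\<close> loses nothing.\<close>
  define red where "red v = (\<lambda>i. nat (v $ i mod int P))" for v :: "int ^ 'n"
  have red: "int (red v i) = v $ i mod int P" for v i
    using P by (simp add: red_def)
  have redU: "red ` V \<subseteq> ?U"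
    using P by (auto simp: red_def nat_less_iff)
  have inj: "inj_on red V"
  proof (rule inj_onI)
    fix v w assume vw: "v \<in> V" "w \<in> V" "red v = red w"
    have "v $ i = w $ i" for i
    proof -
      have "v $ i mod int P = w $ i mod int P" using vw(3) red by metis
      then have "int P dvd v $ i - w $ i" by (simp add: mod_eq_dvd_iff)
      moreover have "\<bar>v $ i - w $ i\<bar> < int P"
      proof -
        have "\<bar>v $ i\<bar> \<le> int T" "\<bar>w $ i\<bar> \<le> int T" using V vw by auto
        then have "\<bar>v $ i - w $ i\<bar> \<le> 2 * int T" by linarith
        also have "2 * T < P"
        proof -
          have "12 * 1 * T \<le> P" unfolding P_def by (intro mult_mono) (auto simp: Suc_le_eq)
          with T show ?thesis by linarith
        qed
        then have "2 * int T < int P" by linarith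
        finally show ?thesis .
      qed
      ultimately show ?thesis using zdvd_not_zless[of "\<bar>v $ i - w $ i\<bar>" "int P"] by force
    qed
    then show "v = w" by (simp add: vec_eq_iff)
  qed
  have phase: "1 / 2 \<le> Re (cis (2 * pi * t (red v) k))" if v: "v \<in> V" and k: "k \<in> S" for v k
  proof -
    obtain b where "infnorm (ivec v v* A - ivec b) < \<delta>"
      using V[OF v] unfolding int_dist_less_iff by blast
    then have b: "\<bar>(ivec v v* A) $ j - of_int (b $ j)\<bar> < \<delta>" for j
      unfolding infnorm_less_iff_cart by (simp add: ivec_def)
    \<comment> \<open>The integer near the phase; its second part undoes the reduction of \<open>v\<close> modulo \<open>P\<close>.\<close>
    define z where "z = (\<Sum>j\<in>UNIV. b $ j * k j) - (\<Sum>i\<in>UNIV. v $ i div int P * g k i)"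
    have dot: "(\<Sum>i\<in>UNIV. of_int (v $ i) * \<theta> k $ i) = (\<Sum>j\<in>UNIV. (ivec v v* A) $ j * of_int (k j))"
    proof -
      have "ivec v \<bullet> (A *v ivec (\<chi> j. k j)) = (ivec v v* A) \<bullet> ivec (\<chi> j. k j)"
        by (simp add: dot_lmul_matrix)
      then show ?thesis by (simp add: inner_vec_def \<theta>_def ivec_def)
    qed
    \<comment> \<open>Error from \<open>v A\<close> being only nearly integral.\<close>
    have e1: "\<bar>(\<Sum>j\<in>UNIV. ((ivec v v* A) $ j - of_int (b $ j)) * of_int (k j))\<bar> \<le> 1 / 12"
    proof -
      have "\<bar>((ivec v v* A) $ j - of_int (b $ j)) * of_int (k j)\<bar> \<le> \<delta> * real K" for j
      proof -
        have "k j \<in> {0..int K}" using k unfolding S_def by blast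
        then have "0 \<le> k j" "k j \<le> int K" by auto
        then have "\<bar>real_of_int (k j)\<bar> \<le> real K" by linarith
        then show ?thesis unfolding abs_mult using b[of j] by (intro mult_mono) auto
      qed
      then have "\<bar>(\<Sum>j\<in>UNIV. ((ivec v v* A) $ j - of_int (b $ j)) * of_int (k j))\<bar>
          \<le> (\<Sum>j\<in>(UNIV::'m set). \<delta> * real K)"
        by (intro order_trans[OF sum_abs] sum_mono)
      also have "\<dots> \<le> 1 / 12" using K by (simp add: mult.commute mult.left_commute)
      finally show ?thesis .
    qed
    \<comment> \<open>Error from rounding \<open>A k\<close> to the grid.\<close>
    have e2: "\<bar>(\<Sum>i\<in>UNIV. of_int (v $ i) * (\<theta> k $ i - of_int (g k i) / real P))\<bar> \<le> 1 / 12"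
    proof -
      have "\<bar>of_int (v $ i) * (\<theta> k $ i - of_int (g k i) / real P)\<bar> \<le> real T * (1 / real P)" for i
      proof -
        have "\<bar>real_of_int (v $ i)\<bar> \<le> real T" using V[OF v] by (metis of_int_abs of_int_le_iff of_int_of_nat_eq)
        then show ?thesis unfolding abs_mult using g(1)[of k i] by (intro mult_mono) auto
      qed
      then have "\<bar>(\<Sum>i\<in>UNIV. of_int (v $ i) * (\<theta> k $ i - of_int (g k i) / real P))\<bar>
          \<le> (\<Sum>i\<in>(UNIV::'n set). real T * (1 / real P))"
        by (intro order_trans[OF sum_abs] sum_mono)
      also have "\<dots> = 1 / 12" using T by (simp add: Pn)
      finally show ?thesis by simp
    qed
    have rd: "real (red v i) = of_int (v $ i) - real P * of_int (v $ i div int P)" for i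
    proof -
      have "int (red v i) = v $ i - int P * (v $ i div int P)"
        unfolding red by (simp add: minus_mult_div_eq_mod)
      then show ?thesis by (metis of_int_diff of_int_mult of_int_of_nat_eq)
    qed
    have "t (red v) k = (\<Sum>i\<in>UNIV. of_int (v $ i) * (of_int (g k i) / real P))
        - of_int (\<Sum>i\<in>UNIV. v $ i div int P * g k i)"
    proof -
      have "(of_int (v $ i) - real P * of_int (v $ i div int P)) * of_int (g k i) / real P
          = of_int (v $ i) * (of_int (g k i) / real P) - of_int (v $ i div int P * g k i)" for i
        using P by (simp add: field_simps)
      then show ?thesis
        unfolding t_def rd sum_divide_distrib by (simp add: sum_subtractf)
    qed
    moreover have "(\<Sum>i\<in>UNIV. of_int (v $ i) * (of_int (g k i) / real P))
        = (\<Sum>i\<in>UNIV. of_int (v $ i) * \<theta> k $ i)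
          - (\<Sum>i\<in>UNIV. of_int (v $ i) * (\<theta> k $ i - of_int (g k i) / real P))"
      by (simp add: right_diff_distrib sum_subtractf)
    moreover have "(\<Sum>j\<in>UNIV. (ivec v v* A) $ j * of_int (k j))
        = (\<Sum>j\<in>UNIV. ((ivec v v* A) $ j - of_int (b $ j)) * of_int (k j)) + of_int (\<Sum>j\<in>UNIV. b $ j * k j)"
      by (simp add: left_diff_distrib sum_subtractf)
    ultimately have "t (red v) k - of_int z
        = (\<Sum>j\<in>UNIV. ((ivec v v* A) $ j - of_int (b $ j)) * of_int (k j))
          - (\<Sum>i\<in>UNIV. of_int (v $ i) * (\<theta> k $ i - of_int (g k i) / real P))"
      unfolding z_def using dot by simp
    then have "\<bar>t (red v) k - of_int z\<bar> \<le> 1 / 6" using e1 e2 by linarith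
    then show ?thesis by (rule Re_cis_near_integer)
  qed
  have large: "(real (card S) / 2)\<^sup>2 \<le> (cmod (\<Sum>k\<in>S. cis (2 * pi * t u k)))\<^sup>2" if u: "u \<in> red ` V" for u
  proof (rule power_mono)
    have "real (card S) / 2 = (\<Sum>k\<in>S. 1 / 2)" by simp
    also have "\<dots> \<le> (\<Sum>k\<in>S. Re (cis (2 * pi * t u k)))"
      using u phase by (intro sum_mono) blast
    also have "\<dots> = Re (\<Sum>k\<in>S. cis (2 * pi * t u k))" by simp
    also have "\<dots> \<le> cmod (\<Sum>k\<in>S. cis (2 * pi * t u k))" by (rule complex_Re_le_cmod)
    finally show "real (card S) / 2 \<le> cmod (\<Sum>k\<in>S. cis (2 * pi * t u k))" .
  qed simp
  have fU: "finite ?U" by (intro finite_PiE) auto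
  have "real (card V) * (real (card S) / 2)\<^sup>2 = (\<Sum>u\<in>red ` V. (real (card S) / 2)\<^sup>2)"
    by (simp add: card_image[OF inj])
  also have "\<dots> \<le> (\<Sum>u\<in>red ` V. (cmod (\<Sum>k\<in>S. cis (2 * pi * t u k)))\<^sup>2)"
    using large by (intro sum_mono)
  also have "\<dots> \<le> (\<Sum>u\<in>?U. (cmod (\<Sum>k\<in>S. cis (2 * pi * t u k)))\<^sup>2)"
    using redU fU by (intro sum_mono2) auto
  also have "\<dots> = real (P ^ CARD('n) * card S)"
    unfolding t_def by (rule parseval_residues[OF P S sep])
  finally have "real (card V) * real (card S) * real (card S) \<le> 4 * real (P ^ CARD('n)) * real (card S)"
    by (simp add: power2_eq_square field_simps)
  moreover have "card S > 0" unfolding cardS by simp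
  ultimately have "real (card V) * real (card S) \<le> 4 * real (P ^ CARD('n))"
    by simp
  then have "real (card V * card S) \<le> real (4 * P ^ CARD('n))" by simp
  then show ?thesis unfolding cardS of_nat_le_iff .
qed

section \<open>The diophantine exponent\<close>

lemma infnorm_ivec_ge_1:
  fixes k :: "int ^ 'n"
  assumes "k \<noteq> 0"
  shows "1 \<le> infnorm (ivec k)"
proof -
  obtain i where "k $ i \<noteq> 0" using assms by (auto simp: vec_eq_iff)
  then have "1 \<le> \<bar>k $ i\<bar>" by linarith
  then have "1 \<le> \<bar>ivec k $ i\<bar>" unfolding ivec_def by (simp flip: of_int_abs)
  also have "\<dots> \<le> infnorm (ivec k)" by (rule component_le_infnorm_cart)
  finally show ?thesis .
qed

lemma int_dist_scaleR_eq_0: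
  assumes "int_dist y = 0"
  shows "int_dist (real t *\<^sub>R y) = 0"
proof (rule ccontr)
  define e where "e = int_dist (real t *\<^sub>R y)"
  assume "int_dist (real t *\<^sub>R y) \<noteq> 0"
  then have "0 < e" using int_dist_nonneg[of "real t *\<^sub>R y"] by (simp add: e_def)
  then have "0 < e / (real t + 1)" using \<open>0 < e\<close> by simp
  then obtain p where p: "infnorm (y - ivec p) < e / (real t + 1)"
    using assms int_dist_less_iff by metis
  have "real t *\<^sub>R y - ivec (\<chi> i. int t * p $ i) = real t *\<^sub>R (y - ivec p)"
    by (simp add: vec_eq_iff ivec_def algebra_simps)
  then have "infnorm (real t *\<^sub>R y - ivec (\<chi> i. int t * p $ i)) = real t * infnorm (y - ivec p)"
    by (simp add: infnorm_mul)
  also have "\<dots> \<le> (real t + 1) * infnorm (y - ivec p)"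
    by (intro mult_right_mono infnorm_pos_le) auto
  also have "\<dots> < e" using p by (simp add: pos_less_divide_eq mult.commute)
  finally have "int_dist (real t *\<^sub>R y) < e" unfolding int_dist_less_iff by blast
  then show False by (simp add: e_def)
qed

text \<open>
  Below the exponent only finitely many \<open>k\<close> violate the bound with constant \<open>1\<close>, and lowering the constant
  takes care of them unless \<open>A k\<close> is at distance \<open>0\<close> from the integer vectors for some \<open>k \<noteq> 0\<close>.  In that
  case all multiples of \<open>k\<close> violate the bound, which contradicts finiteness.
\<close>

lemma dioph_exponent_lower_bound:
  fixes A :: "real ^ 'm ^ 'n"
  assumes w: "dioph_exponent A < ereal w"
  obtains c where "0 < c" "\<And>k :: int ^ 'm. k \<noteq> 0 \<Longrightarrow> c * infnorm (ivec k) powr (- w) \<le> int_dist (A *v ivec k)"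
proof -
  define E where "E = {q :: int ^ 'm. int_dist (A *v ivec q) < infnorm (ivec q) powr (- w)}"
  have finE: "finite E"
  proof (rule ccontr)
    assume "infinite E"
    then have "ereal w \<le> dioph_exponent A"
      unfolding dioph_exponent_def E_def by (intro Sup_upper) auto
    with w show False by simp
  qed
  have pos: "0 < int_dist (A *v ivec k)" if k: "k \<noteq> 0" for k :: "int ^ 'm"
  proof (rule ccontr)
    assume "\<not> 0 < int_dist (A *v ivec k)"
    then have 0: "int_dist (A *v ivec k) = 0" using int_dist_nonneg[of "A *v ivec k"] by linarith
    define mk where "mk t = (\<chi> i. int (Suc t) * k $ i)" for t
    have mk: "ivec (mk t) = real (Suc t) *\<^sub>R ivec k" for t
      by (simp add: vec_eq_iff ivec_def mk_def)
    have "mk t \<in> E" for t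
    proof -
      have "mk t \<noteq> 0" using k by (auto simp: mk_def vec_eq_iff)
      then have "0 < infnorm (ivec (mk t)) powr (- w)" using infnorm_ivec_ge_1[of "mk t"] by simp
      with int_dist_scaleR_eq_0[OF 0, of "Suc t"] show ?thesis
        unfolding E_def by (simp add: mk matrix_vector_mult_scaleR del: of_nat_Suc)
    qed
    moreover have "inj mk"
    proof (rule injI)
      fix s t assume "mk s = mk t"
      moreover obtain i where "k $ i \<noteq> 0" using k by (auto simp: vec_eq_iff)
      ultimately show "s = t" by (auto simp: mk_def vec_eq_iff)
    qed
    ultimately show False using finE by (meson finite_subset image_subset_iff range_inj_infinite)
  qed
  have infnorm_nz: "infnorm (ivec k) \<noteq> 0" if "k \<noteq> 0" for k :: "int ^ 'm"
    using infnorm_ivec_ge_1[OF that] by linarith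
  define c where "c = Min (insert 1 ((\<lambda>k. int_dist (A *v ivec k) / infnorm (ivec k) powr (- w)) ` (E - {0})))"
  have "0 < c"
    unfolding c_def using finE pos infnorm_ivec_ge_1
    by (subst Min_gr_iff) (auto intro!: divide_pos_pos pos simp: infnorm_nz)
  moreover have "c * infnorm (ivec k) powr (- w) \<le> int_dist (A *v ivec k)" if k: "k \<noteq> 0" for k
  proof (cases "k \<in> E")
    case True
    then have "c \<le> int_dist (A *v ivec k) / infnorm (ivec k) powr (- w)"
      unfolding c_def using finE k by (intro Min_le) auto
    moreover have "0 < infnorm (ivec k) powr (- w)" using infnorm_ivec_ge_1[OF k] by simp
    ultimately show ?thesis by (simp add: pos_le_divide_eq)
  next
    case False
    have "c \<le> 1" unfolding c_def using finE by (intro Min_le) auto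
    then have "c * infnorm (ivec k) powr (- w) \<le> 1 * infnorm (ivec k) powr (- w)"
      by (intro mult_right_mono) auto
    also have "\<dots> \<le> int_dist (A *v ivec k)" using False by (simp add: E_def)
    finally show ?thesis .
  qed
  ultimately show thesis by (rule that)
qed

text \<open>
  A positive number below \<open>\<tau>\<^sub>0\<close> forces the exponent to be finite, since otherwise \<open>\<tau>\<^sub>0\<close> would be \<open>0\<close>;
  then the reciprocal in the definition of \<open>\<tau>\<^sub>0\<close> is one of real numbers and reverses the inequality.
\<close>

lemma less_tau0_imp:
  fixes A :: "real ^ 'm ^ 'n"
  assumes "0 < s" "s < tau0 A"
  shows "dioph_exponent A < ereal (1 / s)" "s < 1 / real CARD('m)"
proof -
  define M where "M = max (ereal (real CARD('m))) (dioph_exponent A)"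
  have Mm: "ereal (real CARD('m)) \<le> M" and Mw: "dioph_exponent A \<le> M" by (auto simp: M_def)
  have tau: "tau0 A = real_of_ereal (1 / M)" by (simp add: tau0_def M_def)
  have "M \<noteq> \<infinity>" using assms tau by auto
  moreover have "M \<noteq> - \<infinity>" using Mm by auto
  ultimately obtain r where r: "M = ereal r" by (cases M) auto
  have rm: "real CARD('m) \<le> r" using Mm r by simp
  then have r0: "0 < r" by (metis less_le_trans of_nat_0_less_iff zero_less_card_finite)
  have s: "s < 1 / r" using assms(2) r0 unfolding tau r by (simp add: one_ereal_def)
  then have "r < 1 / s" using r0 assms(1) by (simp add: field_simps)
  then show "dioph_exponent A < ereal (1 / s)" using Mw r by (metis ereal_less(2) less_ereal.simps(1) order_le_less_trans)
  have "1 / r \<le> 1 / real CARD('m)" using rm by (intro divide_left_mono) (auto simp: r0)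
  with s show "s < 1 / real CARD('m)" by linarith
qed

text \<open>
  The admissible \<open>K\<close> in the counting bound is limited by \<open>X\<close>, for the nearly integral \<open>v A\<close>, and by \<open>Y\<close>, for
  the separation of the \<open>A k\<close>.  Each limit contributes one summand.  When the minimum is below \<open>1\<close>, so that
  \<open>K = 0\<close>, the bound survives because it involves \<open>K + 1\<close>.
\<close>

lemma card_near_integral_diophantine:
  fixes A :: "real ^ 'm ^ 'n" and T :: nat and c s \<delta> :: real
  assumes c: "0 < c" and s: "0 < s" and \<delta>: "0 < \<delta>" and T: "1 \<le> T"
    and dual: "\<And>k :: int ^ 'm. k \<noteq> 0 \<Longrightarrow> c * infnorm (ivec k) powr (- (1 / s)) \<le> int_dist (A *v ivec k)"
    and V: "\<And>v. v \<in> V \<Longrightarrow> (\<forall>i. \<bar>v $ i\<bar> \<le> int T) \<and> int_dist (ivec v v* A) < \<delta>"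
  shows "real (card V) \<le> 4 * (12 * real CARD('n) * real T) ^ CARD('n) *
    ((12 * real CARD('m) * \<delta>) ^ CARD('m) + (c * (12 * real CARD('n) * real T)) powr (- (s * real CARD('m))))"
proof -
  define P where "P = 12 * CARD('n) * T"
  have P: "0 < real P" and Pr: "real P = 12 * real CARD('n) * real T" using T by (auto simp: P_def)
  define X where "X = 1 / (12 * real CARD('m) * \<delta>)"
  define Y where "Y = (c * real P) powr s"
  have X: "0 < X" using \<delta> by (simp add: X_def)
  have Y: "0 < Y" using c P by (simp add: Y_def)
  define K where "K = nat \<lfloor>min X Y\<rfloor>"
  have Kle: "real K \<le> X" "real K \<le> Y" and Kge: "min X Y \<le> real (K + 1)"
    using X Y unfolding K_def by linarith+
  have "card V * (K + 1) ^ CARD('m) \<le> 4 * P ^ CARD('n)"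
    unfolding P_def
  proof (rule card_near_integral_le[where A = A and \<delta> = \<delta>])
    show "12 * real CARD('m) * real K * \<delta> \<le> 1"
      using Kle(1) \<delta> by (simp add: X_def pos_le_divide_eq mult.commute mult.left_commute)
    fix k :: "int ^ 'm" assume k: "k \<noteq> 0" and "\<And>j. \<bar>k $ j\<bar> \<le> int K"
    then have "\<bar>ivec k $ j\<bar> \<le> real K" for j
      unfolding ivec_def by simp (metis of_int_abs of_int_le_iff of_int_of_nat_eq)
    then have kK: "infnorm (ivec k) \<le> Y"
      using Kle(2) order_trans unfolding infnorm_le_iff_cart by blast
    have "1 / real P = c * Y powr (- (1 / s))"
      using s c P by (simp add: Y_def powr_powr powr_minus field_simps)
    also have "\<dots> \<le> c * infnorm (ivec k) powr (- (1 / s))"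
      using kK infnorm_ivec_ge_1[OF k] s c by (intro mult_left_mono powr_mono2') auto
    also have "\<dots> \<le> int_dist (A *v ivec k)" by (rule dual[OF k])
    finally show "1 / real (12 * CARD('n) * T) \<le> int_dist (A *v ivec k)" by (simp add: P_def)
  qed (use T V in auto)
  then have "real (card V * (K + 1) ^ CARD('m)) \<le> real (4 * P ^ CARD('n))"
    by (simp only: of_nat_le_iff)
  then have *: "real (card V) * real (K + 1) ^ CARD('m) \<le> 4 * real P ^ CARD('n)" by simp
  have "real (card V) * min X Y ^ CARD('m) \<le> real (card V) * real (K + 1) ^ CARD('m)"
    using Kge X Y by (intro mult_left_mono power_mono) auto
  with * have "real (card V) * min X Y ^ CARD('m) \<le> 4 * real P ^ CARD('n)" by linarith
  then have "real (card V) \<le> 4 * real P ^ CARD('n) * (1 / min X Y ^ CARD('m))"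
    using X Y by (simp add: pos_le_divide_eq)
  also have "\<dots> \<le> 4 * real P ^ CARD('n) * (1 / X ^ CARD('m) + 1 / Y ^ CARD('m))"
    using X Y by (intro mult_left_mono) (auto simp: min_def)
  also have "1 / X ^ CARD('m) = (12 * real CARD('m) * \<delta>) ^ CARD('m)"
    by (simp add: X_def power_divide)
  also have "1 / Y ^ CARD('m) = (c * real P) powr (- (s * real CARD('m)))"
    using c P by (simp add: Y_def powr_minus field_simps powr_powr flip: powr_realpow)
  finally show ?thesis unfolding Pr .
qed

section \<open>Balls for the supremum norm\<close>

lemma sup_ball_eq_box: "sup_ball x r = box (\<chi> i. x $ i - r) (\<chi> i. x $ i + r)"
  by (auto simp: sup_ball_def infnorm_less_iff_cart mem_box_cart abs_less_iff algebra_simps)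

lemma open_sup_ball: "open (sup_ball x r)"
  unfolding sup_ball_eq_box by (rule open_box)

lemma measure_sup_ball:
  fixes x :: "real ^ 'd"
  assumes "0 \<le> r"
  shows "measure lebesgue (sup_ball x r) = (2 * r) ^ CARD('d)"
proof -
  have "measure lebesgue (sup_ball x r) = measure lebesgue (cbox (\<chi> i. x $ i - r) (\<chi> i. x $ i + r))"
    unfolding sup_ball_eq_box by (simp add: measure_lborel_box_eq measure_lborel_cbox_eq)
  also have "\<dots> = measure lborel (cbox (\<chi> i. x $ i - r) (\<chi> i. x $ i + r))"
    by simp
  also have "\<dots> = (\<Prod>i\<in>(UNIV::'d set). (x $ i + r) - (x $ i - r))"
    using assms by (subst content_cbox_cart) (auto simp: interval_eq_empty_cart not_less)
  also have "\<dots> = (2 * r) ^ CARD('d)"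
    by simp
  finally show ?thesis .
qed

lemma lmeasurable_sup_ball: "sup_ball x r \<in> lmeasurable"
  unfolding sup_ball_eq_box by (rule lmeasurable_box)

section \<open>Simultaneous approximation by the pigeonhole principle\<close>

lemma ivec_qa: "qa_vec q a = ivec (\<chi> j. case j of None \<Rightarrow> int q | Some i \<Rightarrow> a $ i)"
  by (auto simp: qa_vec_def ivec_def vec_eq_iff split: option.splits)

text \<open>
  Dirichlet's argument for a system that is not decoupled, since \<open>(q, a) A\<close> involves the numerators.
  This is harmless: attaching to each \<open>q\<close> the numerators \<open>\<lfloor>q x\<rfloor>\<close> makes \<open>(q, a) A\<close> a function of \<open>q\<close>
  alone, and a collision of two \<open>q\<close> in the cells of the fractional parts of \<open>q x\<close> and \<open>(q, a) A\<close> gives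
  the approximation by subtraction.  Distinct \<open>q\<close> give a positive denominator.
\<close>

lemma dirichlet_simultaneous:
  fixes A :: "real ^ 'm ^ (('d::finite) option)" and x :: "real ^ 'd" and Q R S :: nat
  assumes R: "0 < R" and S: "0 < S" and card: "R ^ CARD('d) * S ^ CARD('m) \<le> Q"
  obtains q a where "0 < q" "q \<le> Q" "infnorm (real q *\<^sub>R x - ivec a) < 1 / real R"
    "int_dist (qa_vec q a v* A) < 1 / real S"
proof -
  define y where "y q = (\<chi> i. \<lfloor>real q * x $ i\<rfloor>)" for q :: nat
  define \<xi> where "\<xi> q i = real q * x $ i - of_int (y q $ i)" for q i
  define \<eta> where "\<eta> q j = (qa_vec q (y q) v* A) $ j" for q j
  define f :: "nat \<Rightarrow> ('d \<Rightarrow> int) \<times> ('m \<Rightarrow> int)" where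
    "f q = ((\<lambda>i. \<lfloor>real R * \<xi> q i\<rfloor>), (\<lambda>j. \<lfloor>real S * frac (\<eta> q j)\<rfloor>))" for q
  let ?B = "Pi\<^sub>E UNIV (\<lambda>_::'d. {0..<int R}) \<times> Pi\<^sub>E UNIV (\<lambda>_::'m. {0..<int S})"
  have fl: "\<lfloor>real N * t\<rfloor> \<in> {0..<int N}" if "0 \<le> t" "t < 1" "0 < N" for N t
  proof -
    have "real N * t < real N" using that by simp
    then show ?thesis using that by (auto simp: floor_less_iff)
  qed
  have \<xi>: "0 \<le> \<xi> q i" "\<xi> q i < 1" for q i
    unfolding \<xi>_def y_def by (auto; linarith)+
  have "f ` {0..Q} \<subseteq> ?B"
    using fl[OF \<xi> R] fl[OF frac_ge_0 frac_lt_1 S] unfolding f_def by auto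
  moreover have "finite ?B" by (auto intro!: finite_PiE)
  ultimately have "card (f ` {0..Q}) \<le> card ?B" by (intro card_mono)
  also have "card ?B = R ^ CARD('d) * S ^ CARD('m)"
    by (simp add: card_cartesian_product card_PiE)
  also have "\<dots> < card {0..Q}" using card by simp
  finally have "\<not> inj_on f {0..Q}" by (rule pigeonhole)
  then obtain q1 q2 where q: "q1 < q2" "q2 \<le> Q" and eq: "f q1 = f q2"
    unfolding inj_on_def by (metis atLeastAtMost_iff linorder_neqE_nat)
  have close: "\<bar>s - t\<bar> < 1 / real N" if "\<lfloor>real N * s\<rfloor> = \<lfloor>real N * t\<rfloor>" "0 < N" for s t :: real and N
  proof -
    have "\<bar>real N * (s - t)\<bar> < 1" unfolding right_diff_distrib using that(1) by linarith
    then show ?thesis using that(2) by (simp add: abs_mult pos_less_divide_eq mult.commute)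
  qed
  define q' where "q' = q2 - q1"
  define a where "a = y q2 - y q1"
  show thesis
  proof (rule that)
    show "0 < q'" "q' \<le> Q" using q by (auto simp: q'_def)
    have "\<bar>\<xi> q2 i - \<xi> q1 i\<bar> < 1 / real R" for i
      using eq R by (intro close) (auto simp: f_def fun_eq_iff)
    then show "infnorm (real q' *\<^sub>R x - ivec a) < 1 / real R"
      using q unfolding infnorm_less_iff_cart
      by (simp add: \<xi>_def q'_def a_def ivec_def of_nat_diff algebra_simps)
    have fr: "\<bar>frac (\<eta> q2 j) - frac (\<eta> q1 j)\<bar> < 1 / real S" for j
      using eq S by (intro close) (auto simp: f_def fun_eq_iff)
    have "qa_vec q' a v* A = qa_vec q2 (y q2) v* A - qa_vec q1 (y q1) v* A"
    proof -
      have "qa_vec q' a = qa_vec q2 (y q2) - qa_vec q1 (y q1)"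
        using q by (auto simp: qa_vec_def q'_def a_def vec_eq_iff of_nat_diff split: option.splits)
      then show ?thesis by (simp add: vector_matrix_mult_diff_distrib)
    qed
    then have "(qa_vec q' a v* A - ivec (\<chi> j. \<lfloor>\<eta> q2 j\<rfloor> - \<lfloor>\<eta> q1 j\<rfloor>)) $ j
        = frac (\<eta> q2 j) - frac (\<eta> q1 j)" for j
      by (simp add: \<eta>_def frac_def ivec_def)
    then have frac_close: "\<bar>(qa_vec q' a v* A - ivec (\<chi> j. \<lfloor>\<eta> q2 j\<rfloor> - \<lfloor>\<eta> q1 j\<rfloor>)) $ j\<bar> < 1 / real S" for j
      using fr by simp
    then have "infnorm (qa_vec q' a v* A - ivec (\<chi> j. \<lfloor>\<eta> q2 j\<rfloor> - \<lfloor>\<eta> q1 j\<rfloor>)) < 1 / real S"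
      unfolding infnorm_less_iff_cart by blast
    then show "int_dist (qa_vec q' a v* A) < 1 / real S"
      unfolding int_dist_less_iff by blast
  qed
qed

text \<open>
  Up to the factor \<open>2\<^sup>m\<^sup>+\<^sup>1\<close> this is what Minkowski's theorem on linear forms gives.
  The factor pays for replacing \<open>1/\<delta>\<close> and the reciprocal of the radius by integers.
\<close>

lemma exists_rational_approximation:
  fixes A :: "real ^ 'm ^ (('d::finite) option)" and x :: "real ^ 'd" and Q :: nat and \<delta> :: real
  defines "d \<equiv> real CARD('d)" and "m \<equiv> CARD('m)"
  defines "\<rho> \<equiv> 1 / (real Q powr (1 / d) * \<delta> powr (real m / d))"
  assumes Q: "0 < Q" and \<delta>: "0 < \<delta>" "\<delta> \<le> 1" and small: "2 ^ (m + 1) * \<rho> \<le> 1"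
  obtains q a where "0 < q" "q \<le> Q" "infnorm (real q *\<^sub>R x - ivec a) < 2 ^ (m + 1) * \<rho>"
    "int_dist (qa_vec q a v* A) < \<delta>"
proof -
  have d: "1 \<le> d" by (simp add: d_def Suc_le_eq)
  have \<rho>: "0 < \<rho>" using Q \<delta> by (simp add: \<rho>_def)
  define S where "S = nat \<lceil>1 / \<delta>\<rceil>"
  have "1 \<le> 1 / \<delta>" using \<delta> by simp
  then have Sge: "1 / \<delta> \<le> real S" and Sle: "real S \<le> 2 / \<delta>"
    unfolding S_def by linarith+
  have S: "0 < S" using Sge \<open>1 \<le> 1 / \<delta>\<close> by linarith
  have S\<delta>: "1 / real S \<le> \<delta>" using Sge S \<delta> by (simp add: field_simps)
  define z where "z = (real Q / real S ^ m) powr (1 / d)"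
  have zge: "1 / (2 ^ m * \<rho>) \<le> z"
  proof -
    have "real Q * \<delta> ^ m / 2 ^ m = real Q / (2 / \<delta>) ^ m" by (simp add: power_divide)
    also have "\<dots> \<le> real Q / real S ^ m"
      using Sle S \<delta> by (intro divide_left_mono power_mono mult_pos_pos) auto
    finally have "(real Q * \<delta> ^ m / 2 ^ m) powr (1 / d) \<le> z"
      unfolding z_def using d \<delta> by (intro powr_mono2) auto
    moreover have "(real Q * \<delta> ^ m / 2 ^ m) powr (1 / d) = 1 / \<rho> / 2 powr (real m / d)"
      using Q \<delta> by (simp add: powr_divide powr_mult \<rho>_def powr_powr flip: powr_realpow)
    moreover have "1 / \<rho> / 2 powr real m \<le> 1 / \<rho> / 2 powr (real m / d)"
      using \<rho> d mult_right_mono[of 1 d "real m"]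
      by (intro divide_left_mono powr_mono) (auto simp: pos_divide_le_eq mult.commute)
    ultimately have "1 / \<rho> / 2 powr real m \<le> z" by linarith
    then show ?thesis by (simp add: powr_realpow mult.commute)
  qed
  have inv: "1 / (2 ^ m * \<rho>) = 2 * (1 / (2 ^ (m + 1) * \<rho>))" by simp
  have one: "1 \<le> 1 / (2 ^ (m + 1) * \<rho>)" using small \<rho> by (simp only: le_divide_eq) simp
  define R where "R = nat \<lfloor>z\<rfloor>"
  have Rle: "real R \<le> z" and Rge: "1 / (2 ^ (m + 1) * \<rho>) \<le> real R"
    using zge inv one unfolding R_def by linarith+
  have R: "0 < R" using Rge one by linarith
  have R\<eta>: "1 / real R \<le> 2 ^ (m + 1) * \<rho>"
    using Rge R \<rho> by (simp add: field_simps)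
  have "real R ^ CARD('d) \<le> z ^ CARD('d)" using Rle by (intro power_mono) auto
  also have "\<dots> = real Q / real S ^ m"
    using Q S by (simp add: z_def d_def powr_powr flip: powr_realpow)
  finally have "real (R ^ CARD('d) * S ^ m) \<le> real Q" using S by (simp add: pos_le_divide_eq)
  then have "R ^ CARD('d) * S ^ CARD('m) \<le> Q" unfolding of_nat_le_iff m_def .
  from dirichlet_simultaneous[OF R S this, where x = x and A = A]
  obtain q a where "0 < q" "q \<le> Q" "infnorm (real q *\<^sub>R x - ivec a) < 1 / real R"
    "int_dist (qa_vec q a v* A) < 1 / real S" by blast
  with R\<eta> S\<delta> show thesis by (intro that[of q a]) auto
qed

section \<open>Points close to rationals with small denominator\<close>

lemma finite_bounded_int_vec: "finite {v :: int ^ 'n. \<forall>i. \<bar>v $ i\<bar> \<le> b}"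
proof (rule finite_subset)
  show "{v :: int ^ 'n. \<forall>i. \<bar>v $ i\<bar> \<le> b} \<subseteq> vec_lambda ` Pi\<^sub>E UNIV (\<lambda>_. {-b..b})"
  proof
    fix v :: "int ^ 'n" assume "v \<in> {v. \<forall>i. \<bar>v $ i\<bar> \<le> b}"
    then have "($) v \<in> Pi\<^sub>E UNIV (\<lambda>_. {-b..b})" by (auto simp: abs_le_iff minus_le_iff)
    then show "v \<in> vec_lambda ` Pi\<^sub>E UNIV (\<lambda>_. {-b..b})" by (metis image_eqI vec_nth_inverse)
  qed
qed (auto intro!: finite_PiE)

text \<open>
  A sum of geometrically growing terms is dominated by its last one.
\<close>

lemma dyadic_sum_le:
  fixes \<theta> :: real and M :: nat
  assumes \<theta>: "0 < \<theta>"
  shows "(\<Sum>j | 2 ^ j \<le> M. real (2 ^ j) powr \<theta>) \<le> real M powr \<theta> / (1 - 2 powr (- \<theta>))"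
proof -
  define x :: real where "x = 2 powr \<theta>"
  have x: "1 < x" using \<theta> by (simp add: x_def)
  have xinv: "2 powr (- \<theta>) = 1 / x" by (simp add: x_def powr_minus field_simps)
  have pw: "real (2 ^ j) powr \<theta> = x ^ j" for j
    by (simp add: x_def powr_realpow[symmetric] powr_powr mult.commute)
  have geo: "(\<Sum>j\<le>J. x ^ j) \<le> x ^ J / (1 - 1 / x)" for J
    using x by (induction J) (auto simp: field_simps)
  show ?thesis
  proof (cases "M = 0")
    case True then show ?thesis by simp
  next
    case False
    then obtain J where J: "2 ^ J \<le> M" "M < 2 ^ (J + 1)" using ex_power_ivl1[of 2 M] by auto
    have "{j. 2 ^ j \<le> M} = {..J}"
    proof (intro set_eqI iffI)
      fix j assume "j \<in> {j. 2 ^ j \<le> M}"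
      then have "(2::nat) ^ j < 2 ^ (J + 1)" using J by simp
      then show "j \<in> {..J}" by (simp only: power_strict_increasing_iff) simp
    next
      fix j assume "j \<in> {..J}"
      then have "(2::nat) ^ j \<le> 2 ^ J" by simp
      also note J(1)
      finally show "j \<in> {j. 2 ^ j \<le> M}" by simp
    qed
    then have "(\<Sum>j | 2 ^ j \<le> M. real (2 ^ j) powr \<theta>) = (\<Sum>j\<le>J. x ^ j)" by (simp only: pw)
    also have "\<dots> \<le> x ^ J / (1 - 1 / x)" by (rule geo)
    also have "\<dots> \<le> real M powr \<theta> / (1 - 1 / x)"
    proof (rule divide_right_mono)
      have "real (2 ^ J) \<le> real M" using J(1) by (simp only: of_nat_le_iff)
      then have "real (2 ^ J) powr \<theta> \<le> real M powr \<theta>" using \<theta> by (intro powr_mono2) auto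
      then show "x ^ J \<le> real M powr \<theta>" unfolding pw .
    qed (use x in simp)
    finally show ?thesis unfolding xinv .
  qed
qed

text \<open>
  The bound on the numerators confines \<open>(q, a)\<close> to a box of side comparable to \<open>q\<close>, as the count requires; it
  holds for every pair with \<open>q \<ge> 1\<close> that approximates a point of the unit cube to within \<open>1/q\<close>.
\<close>

definition near_integral_pairs :: "real ^ 'm ^ ('d option) \<Rightarrow> real \<Rightarrow> nat set \<Rightarrow> (nat \<times> (int ^ 'd)) set" where
  "near_integral_pairs A \<delta> I =
    {(q, a). q \<in> I \<and> (\<forall>i. \<bar>a $ i\<bar> \<le> 2 * int q) \<and> int_dist (qa_vec q a v* A) < \<delta>}"

definition rational_cover :: "real ^ 'm ^ ('d option) \<Rightarrow> real \<Rightarrow> real \<Rightarrow> nat set \<Rightarrow> (real ^ 'd) set" where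
  "rational_cover A \<delta> \<eta> I =
    (\<Union>(q, a) \<in> near_integral_pairs A \<delta> I. sup_ball (rat_point q a) (\<eta> / real q))"

lemma finite_near_integral_pairs:
  fixes A :: "real ^ 'm ^ (('d::finite) option)"
  assumes "finite I"
  shows "finite (near_integral_pairs A \<delta> I)"
proof (rule finite_subset)
  show "near_integral_pairs A \<delta> I \<subseteq> (SIGMA q:I. {a. \<forall>i. \<bar>a $ i\<bar> \<le> 2 * int q})"
    by (auto simp: near_integral_pairs_def)
  show "finite (SIGMA q:I. {a :: int ^ 'd. \<forall>i. \<bar>a $ i\<bar> \<le> 2 * int q})"
    using assms finite_bounded_int_vec by (intro finite_SigmaI) auto
qed

lemma lmeasurable_rational_cover:
  fixes A :: "real ^ 'm ^ (('d::finite) option)"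
  assumes "finite I"
  shows "rational_cover A \<delta> \<eta> I \<in> lmeasurable"
  unfolding rational_cover_def using finite_near_integral_pairs[OF assms]
  by (intro fmeasurable.finite_UN) (auto intro: lmeasurable_sup_ball)

text \<open>
  Inside a dyadic block the balls have comparable size, so their number, bounded with \<open>T = 4 N\<close>, times the
  volume of the largest one is not wasteful.
\<close>

lemma measure_rational_cover_block:
  fixes A :: "real ^ 'm ^ (('d::finite) option)" and N :: nat and c s \<delta> \<eta> :: real
  defines "n \<equiv> real (CARD('d) + 1)" and "m \<equiv> CARD('m)" and "d \<equiv> CARD('d)"
  assumes c: "0 < c" and s: "0 < s" and \<delta>: "0 < \<delta>" and \<eta>: "0 \<le> \<eta>" and N: "1 \<le> N"
    and dual: "\<And>k :: int ^ 'm. k \<noteq> 0 \<Longrightarrow> c * infnorm (ivec k) powr (- (1 / s)) \<le> int_dist (A *v ivec k)"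
  shows "measure lebesgue (rational_cover A \<delta> \<eta> {N..<2 * N})
    \<le> 4 * (48 * n) ^ (d + 1) * (2 * \<eta>) ^ d *
      ((12 * real m * \<delta>) ^ m * real N + (48 * n * c) powr (- (s * real m)) * real N powr (1 - s * real m))"
proof -
  let ?G = "near_integral_pairs A \<delta> {N..<2 * N}"
  have fin: "finite ?G" by (rule finite_near_integral_pairs) simp
  \<comment> \<open>The pair \<open>(q, a)\<close> as one integer vector with \<open>d + 1\<close> entries.\<close>
  define vec :: "nat \<times> (int ^ 'd) \<Rightarrow> int ^ ('d option)"
    where "vec = (\<lambda>(q, a). \<chi> j. case j of None \<Rightarrow> int q | Some i \<Rightarrow> a $ i)"
  have inj: "inj_on vec ?G"
  proof (rule inj_onI, clarify)
    fix q a q' and a' :: "int ^ 'd" assume eq: "vec (q, a) = vec (q', a')"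
    have "vec (q, a) $ None = vec (q', a') $ None" "\<And>i. vec (q, a) $ Some i = vec (q', a') $ Some i"
      by (simp_all only: eq)
    then show "q = q' \<and> a = a'" by (simp add: vec_def vec_eq_iff)
  qed
  have CN: "real CARD('d option) = n" "CARD('d option) = d + 1"
    by (simp_all add: n_def d_def card_UNIV_option)
  have "real (card (vec ` ?G)) \<le> 4 * (12 * n * real (4 * N)) ^ (d + 1) *
    ((12 * real m * \<delta>) ^ m + (c * (12 * n * real (4 * N))) powr (- (s * real m)))"
    unfolding CN[symmetric] m_def
  proof (rule card_near_integral_diophantine[OF c s \<delta> _ dual])
    fix v assume "v \<in> vec ` ?G"
    then obtain q a where v: "v = vec (q, a)" and qa: "(q, a) \<in> ?G" by auto
    have "\<bar>v $ i\<bar> \<le> int (4 * N)" for i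
    proof (cases i)
      case None
      then show ?thesis using qa by (simp add: v vec_def near_integral_pairs_def)
    next
      case (Some j)
      have "\<bar>a $ j\<bar> \<le> 2 * int q" "q < 2 * N" using qa by (auto simp: near_integral_pairs_def)
      then have "\<bar>a $ j\<bar> \<le> int (4 * N)" by linarith
      then show ?thesis by (simp add: v vec_def Some)
    qed
    moreover have "int_dist (ivec v v* A) < \<delta>"
      using qa by (simp add: v vec_def near_integral_pairs_def ivec_qa)
    ultimately show "(\<forall>i. \<bar>v $ i\<bar> \<le> int (4 * N)) \<and> int_dist (ivec v v* A) < \<delta>" by blast
  qed (use N in auto)
  then have card: "real (card ?G) \<le> 4 * (48 * n * real N) ^ (d + 1) *
    ((12 * real m * \<delta>) ^ m + (48 * n * c * real N) powr (- (s * real m)))"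
    unfolding card_image[OF inj] by (simp add: mult.commute mult.left_commute)
  have "measure lebesgue (rational_cover A \<delta> \<eta> {N..<2 * N})
      \<le> (\<Sum>p\<in>?G. measure lebesgue (case p of (q, a) \<Rightarrow> sup_ball (rat_point q a) (\<eta> / real q)))"
    unfolding rational_cover_def using fin
    by (intro measure_UNION_le) (auto intro: lmeasurable_sup_ball fmeasurableD)
  also have "\<dots> \<le> (\<Sum>p\<in>?G. (2 * \<eta> / real N) ^ d)"
  proof (rule sum_mono, clarify)
    fix q a assume "(q, a) \<in> ?G"
    then have q: "N \<le> q" by (simp add: near_integral_pairs_def)
    have "measure lebesgue (sup_ball (rat_point q a) (\<eta> / real q)) = (2 * \<eta> / real q) ^ d"
      using \<eta> by (subst measure_sup_ball) (auto simp: d_def)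
    also have "\<dots> \<le> (2 * \<eta> / real N) ^ d"
      using q N \<eta> by (intro power_mono divide_left_mono) auto
    finally show "measure lebesgue (sup_ball (rat_point q a) (\<eta> / real q)) \<le> (2 * \<eta> / real N) ^ d" .
  qed
  also have "\<dots> = real (card ?G) * (2 * \<eta> / real N) ^ d" by simp
  also have "\<dots> \<le> 4 * (48 * n * real N) ^ (d + 1) *
    ((12 * real m * \<delta>) ^ m + (48 * n * c * real N) powr (- (s * real m))) * (2 * \<eta> / real N) ^ d"
    using card \<eta> by (intro mult_right_mono) auto
  also have "(48 * n * c * real N) powr (- (s * real m)) = (48 * n * c) powr (- (s * real m)) * real N powr (- (s * real m))"
    using c by (subst powr_mult) (auto simp: n_def)
  also have "4 * (48 * n * real N) ^ (d + 1) *
    ((12 * real m * \<delta>) ^ m + (48 * n * c) powr (- (s * real m)) * real N powr (- (s * real m))) * (2 * \<eta> / real N) ^ d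
    = 4 * (48 * n) ^ (d + 1) * (2 * \<eta>) ^ d *
      ((12 * real m * \<delta>) ^ m * real N + (48 * n * c) powr (- (s * real m)) * (real N * real N powr (- (s * real m))))"
    using N by (simp add: power_mult_distrib power_divide field_simps)
  also have "real N * real N powr (- (s * real m)) = real N powr (1 - s * real m)"
    using N by (simp add: powr_diff powr_minus field_simps)
  finally show ?thesis .
qed

lemma measure_rational_cover_le:
  fixes A :: "real ^ 'm ^ (('d::finite) option)" and M :: nat and c s \<delta> \<eta> :: real
  defines "n \<equiv> real (CARD('d) + 1)" and "m \<equiv> CARD('m)" and "d \<equiv> CARD('d)"
  assumes c: "0 < c" and s: "0 < s" "s * real m < 1" and \<delta>: "0 < \<delta>" and \<eta>: "0 \<le> \<eta>"
    and dual: "\<And>k :: int ^ 'm. k \<noteq> 0 \<Longrightarrow> c * infnorm (ivec k) powr (- (1 / s)) \<le> int_dist (A *v ivec k)"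
  shows "measure lebesgue (rational_cover A \<delta> \<eta> {1..M})
    \<le> 4 * (48 * n) ^ (d + 1) * (2 * \<eta>) ^ d *
      (2 * (12 * real m * \<delta>) ^ m * real M +
       (48 * n * c) powr (- (s * real m)) / (1 - 2 powr (- (1 - s * real m))) * real M powr (1 - s * real m))"
proof -
  define I where "I = {j. (2::nat) ^ j \<le> M}"
  define \<theta> where "\<theta> = 1 - s * real m"
  have \<theta>: "0 < \<theta>" using s by (simp add: \<theta>_def)
  have "j \<le> M" if "j \<in> I" for j
    using that less_exp[of j] unfolding I_def by (metis less_imp_le mem_Collect_eq order_trans)
  then have "I \<subseteq> {..M}" by blast
  then have fin: "finite I" by (rule finite_subset) simp
  have "rational_cover A \<delta> \<eta> {1..M} \<subseteq> (\<Union>j\<in>I. rational_cover A \<delta> \<eta> {2 ^ j..<2 * 2 ^ j})"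
  proof
    fix y assume "y \<in> rational_cover A \<delta> \<eta> {1..M}"
    then obtain q a where qa: "(q, a) \<in> near_integral_pairs A \<delta> {1..M}"
      and y: "y \<in> sup_ball (rat_point q a) (\<eta> / real q)" by (auto simp: rational_cover_def)
    then have q: "1 \<le> q" "q \<le> M" by (auto simp: near_integral_pairs_def)
    obtain j where j: "2 ^ j \<le> q" "q < 2 ^ (j + 1)" using ex_power_ivl1[of 2 q] q by auto
    have "(q, a) \<in> near_integral_pairs A \<delta> {2 ^ j..<2 * 2 ^ j}"
      using qa j by (simp add: near_integral_pairs_def)
    moreover have "j \<in> I" using j q by (simp add: I_def)
    ultimately show "y \<in> (\<Union>j\<in>I. rational_cover A \<delta> \<eta> {2 ^ j..<2 * 2 ^ j})"
      using y unfolding rational_cover_def by blast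
  qed
  then have "measure lebesgue (rational_cover A \<delta> \<eta> {1..M})
      \<le> measure lebesgue (\<Union>j\<in>I. rational_cover A \<delta> \<eta> {2 ^ j..<2 * 2 ^ j})"
    using fin by (intro measure_mono_fmeasurable fmeasurable.finite_UN fmeasurableD lmeasurable_rational_cover) auto
  also have "\<dots> \<le> (\<Sum>j\<in>I. measure lebesgue (rational_cover A \<delta> \<eta> {2 ^ j..<2 * 2 ^ j}))"
    using fin by (intro measure_UNION_le) (auto intro!: lmeasurable_rational_cover fmeasurableD)
  also have "\<dots> \<le> (\<Sum>j\<in>I. 4 * (48 * n) ^ (d + 1) * (2 * \<eta>) ^ d *
      ((12 * real m * \<delta>) ^ m * real (2 ^ j) powr 1 + (48 * n * c) powr (- (s * real m)) * real (2 ^ j) powr \<theta>))"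
    unfolding n_def m_def d_def \<theta>_def
    by (intro sum_mono order_trans[OF measure_rational_cover_block[OF c s(1) \<delta> \<eta> _ dual]]) simp_all
  also have "\<dots> = 4 * (48 * n) ^ (d + 1) * (2 * \<eta>) ^ d *
      ((12 * real m * \<delta>) ^ m * (\<Sum>j\<in>I. real (2 ^ j) powr 1)
        + (48 * n * c) powr (- (s * real m)) * (\<Sum>j\<in>I. real (2 ^ j) powr \<theta>))"
    unfolding sum_distrib_left[symmetric] sum.distrib ..
  also have "\<dots> \<le> 4 * (48 * n) ^ (d + 1) * (2 * \<eta>) ^ d *
      ((12 * real m * \<delta>) ^ m * (real M powr 1 / (1 - 2 powr (- 1)))
        + (48 * n * c) powr (- (s * real m)) * (real M powr \<theta> / (1 - 2 powr (- \<theta>))))"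
    unfolding I_def using \<eta> \<delta> c \<theta>
    by (intro mult_left_mono add_mono dyadic_sum_le) (auto simp: n_def)
  also have "real M powr 1 / (1 - 2 powr (- 1)) = 2 * real M" by (simp add: powr_minus)
  finally show ?thesis unfolding \<theta>_def by (simp add: mult_ac)
qed

section \<open>Ubiquity of the rational points\<close>

text \<open>
  The volume \<open>Q \<delta>\<^sup>m\<close> grows like a power of \<open>Q\<close>; this is what makes all radii tend to \<open>0\<close>.
\<close>

lemma powr_eps_le_volume:
  fixes Q m \<tau> \<epsilon> \<delta> :: real
  assumes "1 \<le> Q" "0 < m" "m * \<tau> \<le> 1" "Q powr (- \<tau> + \<epsilon>) \<le> \<delta>"
  shows "Q powr (m * \<epsilon>) \<le> Q * \<delta> powr m"
proof -
  have "Q powr (m * \<epsilon>) \<le> Q powr (1 + (- \<tau> + \<epsilon>) * m)"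
    using assms by (intro powr_mono) (auto simp: algebra_simps)
  also have "\<dots> = Q * (Q powr (- \<tau> + \<epsilon>)) powr m"
    using assms by (simp add: powr_add powr_powr)
  also have "\<dots> \<le> Q * \<delta> powr m"
    using assms by (intro mult_left_mono powr_mono2) auto
  finally show ?thesis .
qed

theorem theorem3p4:
  fixes x :: "real ^ 'd" and r :: real
  assumes "0 < r" and "sup_ball x r \<subseteq> unit_cube"
  shows "\<exists>\<kappa>::real. 0 < \<kappa> \<and> \<kappa> < 1 \<and>
    (\<forall>(A :: real ^ 'm ^ ('d option)) \<epsilon>::real. 0 < \<epsilon> \<and> \<epsilon> < tau0 A \<longrightarrow>
      (\<exists>Q0::real. \<forall>(Q::nat) \<delta>::real.
        0 < Q \<and> Q0 \<le> real Q \<and> real Q powr (- tau0 A + \<epsilon>) \<le> \<delta> \<and> \<delta> \<le> 1 \<longrightarrow>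
        measure lebesgue
          (sup_ball x r \<inter>
            (\<Union>(q, a) \<in> approx_set A \<kappa> Q \<delta>.
              sup_ball (rat_point q a)
                (inverse \<kappa> /
                  (real Q powr (real (CARD('d) + 1) / real CARD('d)) *
                   \<delta> powr (real CARD('m) / real CARD('d))))))
        \<ge> 1 / 2 * measure lebesgue (sup_ball x r)))"
proof -
  define d where "d = CARD('d)"
  define m where "m = CARD('m)"
  define n where "n = real (CARD('d) + 1)"
  have d: "1 \<le> d" and m: "1 \<le> m" and n: "0 < n" by (simp_all add: d_def m_def n_def Suc_le_eq)
  define \<mu> where "\<mu> = measure lebesgue (sup_ball x r)"
  have \<mu>: "\<mu> = (2 * r) ^ d" "0 < \<mu>"
    using \<open>0 < r\<close> by (simp_all add: \<mu>_def d_def measure_sup_ball)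
  \<comment> \<open>\<open>C\<close> collects the constants of the bound for the bad set; \<open>\<beta>\<close> makes its main part at most an eighth
      of the ball.  Both depend on the ball and on the dimensions alone, so that \<open>\<kappa>\<close> does not depend on \<open>A\<close>.\<close>
  define C where "C = 4 * (48 * n) ^ (d + 1) * (2 * 2 ^ (m + 1)) ^ d"
  have C: "0 < C" using n by (simp add: C_def)
  define \<beta> where "\<beta> = min (1 / 2) (\<mu> / (8 * (C * (2 * (12 * real m) ^ m))))"
  have \<beta>: "0 < \<beta>" "\<beta> < 1" "C * (2 * (12 * real m) ^ m) * \<beta> \<le> \<mu> / 8"
  proof -
    have D: "0 < C * (2 * (12 * real m) ^ m)" using C m by simp
    then show "0 < \<beta>" "\<beta> < 1" using \<mu> by (auto simp: \<beta>_def)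
    have "\<beta> \<le> \<mu> / (8 * (C * (2 * (12 * real m) ^ m)))" by (simp add: \<beta>_def)
    then show "C * (2 * (12 * real m) ^ m) * \<beta> \<le> \<mu> / 8" using D by (simp add: field_simps)
  qed
  define \<kappa> where "\<kappa> = \<beta> / 2 ^ (m + 1)"
  have \<kappa>: "0 < \<kappa>" "\<kappa> \<le> \<beta>" "\<kappa> < 1"
  proof -
    show "0 < \<kappa>" using \<beta> by (simp add: \<kappa>_def)
    have "(1::real) \<le> 2 ^ (m + 1)" by (rule one_le_power) simp
    then show "\<kappa> \<le> \<beta>" using \<beta> unfolding \<kappa>_def by (simp add: divide_le_eq mult_le_cancel_left1 del: power_Suc)
    with \<beta> show "\<kappa> < 1" by linarith
  qed
  have main: "\<exists>Q0::real. \<forall>(Q::nat) \<delta>::real.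
        0 < Q \<and> Q0 \<le> real Q \<and> real Q powr (- tau0 A + \<epsilon>) \<le> \<delta> \<and> \<delta> \<le> 1 \<longrightarrow>
        measure lebesgue
          (sup_ball x r \<inter>
            (\<Union>(q, a) \<in> approx_set A \<kappa> Q \<delta>.
              sup_ball (rat_point q a)
                (inverse \<kappa> /
                  (real Q powr (real (CARD('d) + 1) / real CARD('d)) *
                   \<delta> powr (real CARD('m) / real CARD('d))))))
        \<ge> 1 / 2 * measure lebesgue (sup_ball x r)"
    if \<epsilon>: "0 < \<epsilon>" "\<epsilon> < tau0 A" for A :: "real ^ 'm ^ ('d option)" and \<epsilon> :: real
  proof -
    \<comment> \<open>Halfway between \<open>\<tau>\<^sub>0 - \<epsilon>\<close> and \<open>\<tau>\<^sub>0\<close>: below \<open>\<tau>\<^sub>0\<close> for the lower bound on \<open>A k\<close>, above \<open>\<tau>\<^sub>0 - \<epsilon>\<close> for decay in \<open>Q\<close>.\<close>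
    define s where "s = tau0 A - \<epsilon> / 2"
    have s: "0 < s" "s < tau0 A" using \<epsilon> by (auto simp: s_def)
    have sm: "s * real m < 1"
      using less_tau0_imp(2)[OF s] m by (simp add: m_def field_simps)
    have tm: "real m * tau0 A \<le> 1"
    proof (rule ccontr)
      assume "\<not> ?thesis"
      then have "1 / real m < tau0 A" using m by (simp add: field_simps)
      from less_tau0_imp(2)[OF _ this] m show False by (simp add: m_def)
    qed
    obtain c where c: "0 < c"
      and dual: "\<And>k :: int ^ 'm. k \<noteq> 0 \<Longrightarrow> c * infnorm (ivec k) powr (- (1 / s)) \<le> int_dist (A *v ivec k)"
      using dioph_exponent_lower_bound[OF less_tau0_imp(1)[OF s]] by blast
    define E where "E = C * ((48 * n * c) powr (- (s * real m)) / (1 - 2 powr (- (1 - s * real m))))"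
    \<comment> \<open>For large \<open>Q\<close>: the part of the bad set that depends on \<open>A\<close> is small, \<open>\<eta> \<le> 1\<close>, and the radius of the
        covering balls is at most \<open>r / (4 d)\<close>.\<close>
    have "eventually (\<lambda>Q. E * Q powr (- (real m * \<epsilon> / 2)) < \<mu> / 8) at_top"
    proof (rule order_tendstoD)
      have "((\<lambda>Q. E * Q powr (- (real m * \<epsilon> / 2))) \<longlongrightarrow> E * 0) at_top"
        using m \<epsilon> by (intro tendsto_mult tendsto_const tendsto_neg_powr filterlim_ident) auto
      then show "((\<lambda>Q. E * Q powr (- (real m * \<epsilon> / 2))) \<longlongrightarrow> 0) at_top" by simp
    qed (use \<mu> in simp)
    moreover have "eventually (\<lambda>Q. 2 ^ (m + 1) * Q powr (- (real m * \<epsilon> / real d)) < 1) at_top"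
    proof (rule order_tendstoD)
      have "((\<lambda>Q. 2 ^ (m + 1) * Q powr (- (real m * \<epsilon> / real d))) \<longlongrightarrow> 2 ^ (m + 1) * 0) at_top"
        using m d \<epsilon> by (intro tendsto_mult tendsto_const tendsto_neg_powr filterlim_ident) auto
      then show "((\<lambda>Q. 2 ^ (m + 1) * Q powr (- (real m * \<epsilon> / real d))) \<longlongrightarrow> 0) at_top" by simp
    qed simp
    moreover have "eventually (\<lambda>Q::real. 4 * real d / (\<kappa> * r) \<le> Q) at_top" by (rule eventually_ge_at_top)
    ultimately have "eventually (\<lambda>Q. E * Q powr (- (real m * \<epsilon> / 2)) < \<mu> / 8
        \<and> 2 ^ (m + 1) * Q powr (- (real m * \<epsilon> / real d)) < 1 \<and> 4 * real d / (\<kappa> * r) \<le> Q) at_top"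
      by (intro eventually_conj)
    then obtain Q0 where Q0: "\<And>Q. Q0 \<le> Q \<Longrightarrow> E * Q powr (- (real m * \<epsilon> / 2)) < \<mu> / 8"
      "\<And>Q. Q0 \<le> Q \<Longrightarrow> 2 ^ (m + 1) * Q powr (- (real m * \<epsilon> / real d)) < 1"
      "\<And>Q. Q0 \<le> Q \<Longrightarrow> 4 * real d / (\<kappa> * r) \<le> Q"
      unfolding eventually_at_top_linorder by blast
    show ?thesis
    proof (intro exI[of _ Q0] allI impI, elim conjE)
      fix Q :: nat and \<delta> :: real
      assume Q: "0 < Q" and QQ0: "Q0 \<le> real Q" and \<delta>Q: "real Q powr (- tau0 A + \<epsilon>) \<le> \<delta>" and \<delta>1: "\<delta> \<le> 1"
      have Q1: "1 \<le> real Q" using Q by linarith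
      have \<delta>: "0 < \<delta>" using \<delta>Q Q by (smt (verit) powr_gt_zero of_nat_0_less_iff)
      have QV: "real Q powr (real m * \<epsilon>) \<le> real Q * \<delta> powr real m"
        using powr_eps_le_volume[of "real Q" "real m" "tau0 A" \<epsilon> \<delta>] Q1 m \<delta>Q tm by simp
      define \<rho> where "\<rho> = 1 / (real Q powr (1 / real d) * \<delta> powr (real m / real d))"
      define \<eta> where "\<eta> = 2 ^ (m + 1) * \<rho>"
      have \<rho>: "0 < \<rho>" using Q \<delta> by (simp add: \<rho>_def)
      have \<eta>: "0 < \<eta>" using \<rho> by (simp add: \<eta>_def)
      have \<rho>d: "\<rho> ^ d = 1 / (real Q * \<delta> ^ m)"
        using Q \<delta> d by (simp add: \<rho>_def power_divide power_mult_distrib powr_powr flip: powr_realpow)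
      have "\<rho> = (real Q * \<delta> powr real m) powr (- (1 / real d))"
        using Q \<delta> by (simp add: \<rho>_def powr_mult powr_powr powr_minus field_simps)
      also have "\<dots> \<le> (real Q powr (real m * \<epsilon>)) powr (- (1 / real d))"
        using QV Q d by (intro powr_mono2') auto
      also have "\<dots> = real Q powr (- (real m * \<epsilon> / real d))"
        by (simp add: powr_powr)
      finally have "\<eta> \<le> 2 ^ (m + 1) * real Q powr (- (real m * \<epsilon> / real d))"
        unfolding \<eta>_def by (intro mult_left_mono) auto
      with Q0(2)[OF QQ0] have \<eta>1: "\<eta> \<le> 1" by linarith
      have "1 * \<rho> \<le> \<eta>" unfolding \<eta>_def using \<rho> by (intro mult_right_mono one_le_power) auto
      with \<eta>1 have \<rho>1: "\<rho> \<le> 1" by simp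
      define rad where "rad = inverse \<kappa> / (real Q powr (real (CARD('d) + 1) / real CARD('d)) *
                   \<delta> powr (real CARD('m) / real CARD('d)))"
      have rad: "rad = \<rho> / (\<kappa> * real Q)"
      proof -
        have "real (CARD('d) + 1) / real CARD('d) = 1 + 1 / real d"
          using d by (simp add: d_def field_simps)
        then have "real Q powr (real (CARD('d) + 1) / real CARD('d)) = real Q * real Q powr (1 / real d)"
          using Q by (simp add: powr_add)
        then show ?thesis unfolding rad_def \<rho>_def by (simp add: d_def m_def field_simps)
      qed
      have rad': "rad = \<eta> / (\<beta> * real Q)"
        unfolding rad \<eta>_def \<kappa>_def by simp
      \<comment> \<open>A concentric ball, small enough that the rational points near it stay in the original ball and hence in
          the unit cube, and large enough to keep three quarters of the measure.\<close>
      define t where "t = r * (1 - 1 / (4 * real d))"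
      have t: "0 \<le> t" using d \<open>0 < r\<close> by (simp add: t_def)
      have radt: "rad + t \<le> r"
      proof -
        have "rad \<le> 1 / (\<kappa> * real Q)" unfolding rad using \<rho>1 \<kappa> Q by (intro divide_right_mono) auto
        also have "\<dots> \<le> r / (4 * real d)"
          using Q0(3)[OF QQ0] Q \<kappa> \<open>0 < r\<close> d by (simp add: field_simps)
        finally show ?thesis by (simp add: t_def algebra_simps)
      qed
      have radpos: "0 < rad" unfolding rad using \<rho> \<kappa> Q by simp
      define M where "M = nat \<lfloor>\<beta> * real Q\<rfloor>"
      have M: "real M \<le> \<beta> * real Q" "\<And>q::nat. M < q \<Longrightarrow> \<beta> * real Q < real q"
        using \<beta> Q unfolding M_def by (auto simp: mult_nonneg_nonneg) linarith+
      let ?B = "sup_ball x r" and ?B' = "sup_ball x t"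
      let ?bad = "rational_cover A \<delta> \<eta> {1..M}"
      define good where "good = (\<Union>(q, a) \<in> approx_set A \<kappa> Q \<delta>. sup_ball (rat_point q a) rad)"
      have cover: "?B' \<subseteq> (?B \<inter> good) \<union> ?bad"
      proof
        fix y assume "y \<in> ?B'"
        then have yt: "infnorm (y - x) < t" by (simp add: sup_ball_def)
        then have yB: "y \<in> ?B" using radt radpos by (simp add: sup_ball_def)
        then have yU: "0 \<le> y $ i" "y $ i \<le> 1" for i using assms(2) by (auto simp: unit_cube_def)
        obtain q a where q: "0 < q" "q \<le> Q" and qa: "infnorm (real q *\<^sub>R y - ivec a) < \<eta>"
          and qaA: "int_dist (qa_vec q a v* A) < \<delta>"
          using exists_rational_approximation[of Q \<delta>, where A = A and x = y] Q \<delta> \<delta>1 \<eta>1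
          unfolding \<eta>_def \<rho>_def d_def m_def by blast
        have near: "infnorm (y - rat_point q a) < \<eta> / real q"
        proof -
          have "y - rat_point q a = (1 / real q) *\<^sub>R (real q *\<^sub>R y - ivec a)"
            using q by (simp add: rat_point_def algebra_simps)
          then show ?thesis using qa q by (simp add: infnorm_mul divide_strict_right_mono)
        qed
        show "y \<in> (?B \<inter> good) \<union> ?bad"
        proof (cases "q \<le> M")
          case True
          have "\<bar>a $ i\<bar> \<le> 2 * int q" for i
          proof -
            have "\<bar>real q * y $ i - of_int (a $ i)\<bar> < 1"
              using qa \<eta>1 less_le_trans unfolding infnorm_less_iff_cart by (fastforce simp: ivec_def)
            moreover have "0 \<le> real q * y $ i" "real q * y $ i \<le> real q"
              using yU[of i] by (auto simp: mult_left_le)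
            ultimately have "\<bar>real_of_int (a $ i)\<bar> \<le> 2 * real q" using q by linarith
            then show ?thesis by linarith
          qed
          then have "(q, a) \<in> near_integral_pairs A \<delta> {1..M}"
            using q True qaA by (simp add: near_integral_pairs_def)
          then have "y \<in> ?bad" unfolding rational_cover_def using near by (auto simp: sup_ball_def)
          then show ?thesis ..
        next
          case False
          then have q\<beta>: "\<beta> * real Q < real q" using M(2) by simp
          have "\<eta> / real q \<le> rad"
            unfolding rad' using q\<beta> \<eta> \<beta> Q q(1) by (intro divide_left_mono) auto
          with near have near': "infnorm (y - rat_point q a) < rad" by linarith
          have "rat_point q a \<in> ?B"
          proof -
            have "infnorm (rat_point q a - x) \<le> infnorm (rat_point q a - y) + infnorm (y - x)"
              using infnorm_triangle[of "rat_point q a - y" "y - x"] by simp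
            also have "\<dots> < rad + t" using near' yt by (simp add: infnorm_sub)
            finally show ?thesis using radt by (simp add: sup_ball_def)
          qed
          then have "rat_point q a \<in> unit_cube" using assms(2) by blast
          moreover have "\<kappa> * real Q < real q"
            using q\<beta> \<kappa>(2) mult_right_mono[of \<kappa> \<beta> "real Q"] by linarith
          ultimately have "(q, a) \<in> approx_set A \<kappa> Q \<delta>"
            using q qaA by (simp add: approx_set_def)
          then have "y \<in> good" unfolding good_def using near' by (auto simp: sup_ball_def)
          with yB show ?thesis by blast
        qed
      qed
      have bad: "measure lebesgue ?bad \<le> \<mu> / 4"
      proof -
        have "2 powr (- (1 - s * real m)) < (2::real) powr 0" using sm by (intro powr_less_mono) auto
        then have \<theta>: "0 < 1 - 2 powr (- (1 - s * real m))" by simp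
        have "measure lebesgue ?bad \<le> 4 * (48 * n) ^ (d + 1) * (2 * \<eta>) ^ d *
          (2 * (12 * real m * \<delta>) ^ m * real M +
           (48 * n * c) powr (- (s * real m)) / (1 - 2 powr (- (1 - s * real m))) * real M powr (1 - s * real m))"
          unfolding n_def m_def d_def
          using measure_rational_cover_le[OF c s(1) _ \<delta> _ dual, of \<eta> M] sm \<eta> by (simp add: m_def)
        also have "\<dots> \<le> 4 * (48 * n) ^ (d + 1) * (2 * \<eta>) ^ d *
          (2 * (12 * real m * \<delta>) ^ m * (\<beta> * real Q) +
           (48 * n * c) powr (- (s * real m)) / (1 - 2 powr (- (1 - s * real m))) * real Q powr (1 - s * real m))"
        proof -
          have "real M \<le> real Q" using M(1) \<beta> mult_right_mono[of \<beta> 1 "real Q"] by linarith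
          then show ?thesis
            using M(1) \<eta> \<delta> n \<theta> sm by (intro mult_left_mono add_mono powr_mono2) auto
        qed
        also have "4 * (48 * n) ^ (d + 1) * (2 * \<eta>) ^ d = C / (real Q * \<delta> ^ m)"
          unfolding \<eta>_def C_def by (simp add: power_mult_distrib \<rho>d)
        also have "C / (real Q * \<delta> ^ m) * (2 * (12 * real m * \<delta>) ^ m * (\<beta> * real Q) +
           (48 * n * c) powr (- (s * real m)) / (1 - 2 powr (- (1 - s * real m))) * real Q powr (1 - s * real m))
          = C * (2 * (12 * real m) ^ m) * \<beta> + E * (real Q powr (1 - s * real m) / (real Q * \<delta> ^ m))"
        proof -
          have *: "C / (Q' * D) * (2 * (K * D) * (\<beta> * Q') + F * G) = C * (2 * K) * \<beta> + C * F * (G / (Q' * D))"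
            if "Q' \<noteq> 0" "D \<noteq> 0" for Q' D K F G :: real
            using that by (simp add: field_simps)
          show ?thesis unfolding E_def power_mult_distrib[of _ \<delta>] using Q \<delta> by (intro *) auto
        qed
        also have "\<dots> \<le> \<mu> / 8 + \<mu> / 8"
        proof (rule add_mono[OF \<beta>(3)])
          have E: "0 \<le> E" unfolding E_def using C \<theta> by simp
          have "real Q powr (1 - s * real m) / (real Q * \<delta> ^ m)
              = real Q powr (- (s * real m)) / \<delta> powr real m"
            using Q \<delta> by (simp add: powr_realpow powr_diff powr_minus field_simps)
          also have "\<dots> \<le> real Q powr (- (s * real m)) / (real Q powr (- tau0 A + \<epsilon>)) powr real m"
            using \<delta>Q \<delta> Q by (intro divide_left_mono powr_mono2) auto
          also have "\<dots> = real Q powr (- (s * real m) - (- tau0 A + \<epsilon>) * real m)"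
            by (simp only: powr_powr powr_diff)
          also have "- (s * real m) - (- tau0 A + \<epsilon>) * real m = - (real m * \<epsilon> / 2)"
            by (simp add: s_def field_simps)
          finally have "E * (real Q powr (1 - s * real m) / (real Q * \<delta> ^ m))
              \<le> E * real Q powr (- (real m * \<epsilon> / 2))"
            using E by (rule mult_left_mono)
          with Q0(1)[OF QQ0]
          show "E * (real Q powr (1 - s * real m) / (real Q * \<delta> ^ m)) \<le> \<mu> / 8"
            by linarith
        qed
        finally show ?thesis by simp
      qed
      have shrink: "3 / 4 * \<mu> \<le> measure lebesgue ?B'"
      proof -
        have "1 + real d * (- (1 / (4 * real d))) \<le> (1 + (- (1 / (4 * real d)))) ^ d"
          using d by (intro Bernoulli_inequality) (simp add: field_simps)
        then have "3 / 4 \<le> (1 - 1 / (4 * real d)) ^ d" using d by simp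
        then have "\<mu> * (3 / 4) \<le> \<mu> * (1 - 1 / (4 * real d)) ^ d" using \<mu> by (intro mult_left_mono) auto
        also have "\<dots> = (2 * t) ^ d" unfolding \<mu> t_def by (simp add: power_mult_distrib)
        also have "\<dots> = measure lebesgue ?B'" using t by (simp add: measure_sup_ball d_def)
        finally show ?thesis by simp
      qed
      have lm: "?B \<inter> good \<in> lmeasurable"
      proof (rule fmeasurable_Int_fmeasurable[OF lmeasurable_sup_ball])
        have "open good" unfolding good_def by (intro open_UN) (auto intro: open_sup_ball)
        then show "good \<in> sets lebesgue" by simp
      qed
      have lb: "?bad \<in> lmeasurable" by (rule lmeasurable_rational_cover) simp
      have "measure lebesgue ?B' \<le> measure lebesgue ((?B \<inter> good) \<union> ?bad)"
        using cover lm lb lmeasurable_sup_ball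
        by (intro measure_mono_fmeasurable fmeasurable.Un fmeasurableD) auto
      also have "\<dots> \<le> measure lebesgue (?B \<inter> good) + measure lebesgue ?bad"
        using lm lb by (intro measure_Un_le) (auto intro: fmeasurableD)
      finally have "1 / 2 * \<mu> \<le> measure lebesgue (?B \<inter> good)"
        using bad shrink by linarith
      then show "1 / 2 * measure lebesgue ?B \<le> measure lebesgue
          (?B \<inter> (\<Union>(q, a) \<in> approx_set A \<kappa> Q \<delta>. sup_ball (rat_point q a)
                (inverse \<kappa> / (real Q powr (real (CARD('d) + 1) / real CARD('d)) *
                   \<delta> powr (real CARD('m) / real CARD('d))))))"
        unfolding good_def rad_def \<mu>_def .
    qed
  qed
  show ?thesis
    using \<kappa> main by (intro exI[of _ \<kappa>]) blast
qed

end
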